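(* Let $p(\cdot|x)$ be a probability density (the posterior) on the latent space $\mathbb{R}^d$, let $c(z,z')$ be a cost function on $\mathbb{R}^d\times\mathbb{R}^d$, and let $z^1,\dots,z^N\in\mathbb{R}^d$ be particle positions. The optimization problem $$\operatorname*{arg\,inf}_{\beta_1,\dots,\beta_N}\left[\ \inf_{\zeta(z'|z)\in Z[q_N,p]}\ \sum_{j=1}^N \beta_j\,\mathbb{E}_{z'\sim\zeta(z'|z^j)}\left[c(z^j,z')\right]\right]$$ is solved by the following tessellation of the latent space: $$L_j=\{z' : \ c(z^j,z')<c(z^k,z')\ \text{ for all } k\neq j\},\qquad j=1,\dots,N,$$ with optimal transportation densities $\zeta(\cdot|z^j)=p_j(\cdot|x)$ obtained by restricting $p$ to each set of the tessellation: $$p_j(z|x)=\frac{1}{\beta_j^*}\,p(z|x)\,\mathcal{I}_j(z),$$ where $\mathcal{I}_j$ is the indicator function of the set $L_j$. The optimal weights are $$\beta_j^*=\int_{L_j}p(z|x)\,dz .$$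
   Context: The particle approximation is the weighted discrete distribution $q_N(z)=\sum_{j=1}^N\beta_j\,\delta(z-z^j)$, where $\beta_j$ is the weight of the $j$-th particle. $Z[q_N,p]$ is the set of families of conditional distributions (transportation densities) $\zeta(z'|z)$ satisfying the marginalization constraint $\sum_{j=1}^N\beta_j\,\zeta(z'|z^j)=p(z'|x)$. The inner infimum is the semi-discrete optimal transport divergence between $q_N$ and $p(\cdot|x)$ with cost $c$, i.e. the infimum of the expected cost over all couplings of $q_N$ and $p(\cdot|x)$. The minimization is thus joint over the weights and the transportation densities, with the particle positions fixed.
   Formalization: Assumes the sets L_j cover the space up to a p-null set (with ties of positive mass the weights β* do not sum to 1), and that each c(z^j,·) is measurable with p-integrable negative part; the formula for p_j is claimed only when β_j* is nonzero. *)

theory Defs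
  imports "HOL-Probability.Probability"
begin

definition prob_density :: "('a::euclidean_space \<Rightarrow> real) \<Rightarrow> bool" where
  "prob_density p \<longleftrightarrow> p \<in> borel_measurable borel \<and> (\<forall>z. 0 \<le> p z) \<and>
     prob_space (density lborel (\<lambda>z. ennreal (p z)))"

(* Expectation with values in the extended reals, so that an infinite expected cost really is
   infinite; the Bochner integral would return 0. It is meaningful when the second integral,
   that of the negative part, is finite. *)
definition ext_expectation :: "'a measure \<Rightarrow> ('a \<Rightarrow> real) \<Rightarrow> ereal" where
  "ext_expectation M f =
     enn2ereal (\<integral>\<^sup>+ y. ennreal (f y) \<partial>M) - enn2ereal (\<integral>\<^sup>+ y. ennreal (- f y) \<partial>M)"

(* The weights for which the particle approximation, sum of beta_j delta_(z^j), is a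
   probability distribution. *)
definition particle_weights :: "nat \<Rightarrow> (nat \<Rightarrow> real) \<Rightarrow> bool" where
  "particle_weights N \<beta> \<longleftrightarrow> (\<forall>j\<in>{1..N}. 0 \<le> \<beta> j) \<and> (\<Sum>j=1..N. \<beta> j) = 1"

(* The set Z[q_N, p]; "\<zeta> y y'" is the conditional density of y' given y. Only the values at the
   particle positions matter, and the marginal constraint between densities is an equality
   almost everywhere. *)
definition transport_densities ::
  "nat \<Rightarrow> (nat \<Rightarrow> 'a::euclidean_space) \<Rightarrow> (nat \<Rightarrow> real) \<Rightarrow> ('a \<Rightarrow> real) \<Rightarrow> ('a \<Rightarrow> 'a \<Rightarrow> real) set" where
  "transport_densities N z \<beta> p =
     {\<zeta>. (\<forall>j\<in>{1..N}. prob_density (\<zeta> (z j))) \<and>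
          (AE z' in lborel. (\<Sum>j=1..N. \<beta> j * \<zeta> (z j) z') = p z')}"

definition transport_cost ::
  "('a \<Rightarrow> 'a \<Rightarrow> real) \<Rightarrow> nat \<Rightarrow> (nat \<Rightarrow> 'a::euclidean_space) \<Rightarrow> (nat \<Rightarrow> real) \<Rightarrow> ('a \<Rightarrow> 'a \<Rightarrow> real) \<Rightarrow> ereal" where
  "transport_cost c N z \<beta> \<zeta> =
     (\<Sum>j=1..N. ereal (\<beta> j) *
        ext_expectation (density lborel (\<lambda>z'. ennreal (\<zeta> (z j) z'))) (\<lambda>z'. c (z j) z'))"

definition ot_divergence ::
  "('a \<Rightarrow> 'a \<Rightarrow> real) \<Rightarrow> nat \<Rightarrow> (nat \<Rightarrow> 'a::euclidean_space) \<Rightarrow> ('a \<Rightarrow> real) \<Rightarrow> (nat \<Rightarrow> real) \<Rightarrow> ereal" where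
  "ot_divergence c N z p \<beta> = (INF \<zeta>\<in>transport_densities N z \<beta> p. transport_cost c N z \<beta> \<zeta>)"

definition cell :: "('a \<Rightarrow> 'a \<Rightarrow> real) \<Rightarrow> nat \<Rightarrow> (nat \<Rightarrow> 'a) \<Rightarrow> nat \<Rightarrow> 'a set" where
  "cell c N z j = {z'. \<forall>k\<in>{1..N}. k \<noteq> j \<longrightarrow> c (z j) z' < c (z k) z'}"

definition opt_weight ::
  "('a \<Rightarrow> 'a \<Rightarrow> real) \<Rightarrow> nat \<Rightarrow> (nat \<Rightarrow> 'a::euclidean_space) \<Rightarrow> ('a \<Rightarrow> real) \<Rightarrow> nat \<Rightarrow> real" where
  "opt_weight c N z p j = (LINT y:cell c N z j|lborel. p y)"

(* A probability density only if "opt_weight c N z p j \<noteq> 0". *)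
definition restricted_density ::
  "('a \<Rightarrow> 'a \<Rightarrow> real) \<Rightarrow> nat \<Rightarrow> (nat \<Rightarrow> 'a::euclidean_space) \<Rightarrow> ('a \<Rightarrow> real) \<Rightarrow> nat \<Rightarrow> 'a \<Rightarrow> real" where
  "restricted_density c N z p j y =
     1 / opt_weight c N z p j * p y * indicator (cell c N z j) y"

end

(* Write a plan (beta, zeta) through its joint densities a_j(y) = beta_j * zeta(z_j, y), whose sum over
   j is p(y). Its cost is the integral of sum_j a_j(y) * c(z_j, y), and pointwise this sum is at
   least p(y) * min_j c(z_j, y), with equality as soon as a_j vanishes off the set where c(z_j, y)
   is minimal. The restriction of p to the cells is such a plan, for the weights beta*. *)
theory Submission imports Defs begin

section \<open>Probability densities and differences of extended nonnegative reals\<close>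

lemma prob_density_iff:
  "prob_density p \<longleftrightarrow> p \<in> borel_measurable borel \<and> (\<forall>z. 0 \<le> p z) \<and>
     (\<integral>\<^sup>+ z. ennreal (p z) \<partial>lborel) = 1"
proof -
  have "prob_space (density lborel (\<lambda>z. ennreal (p z))) \<longleftrightarrow> (\<integral>\<^sup>+ z. ennreal (p z) \<partial>lborel) = 1"
    if "p \<in> borel_measurable borel"
    using that by (auto simp: emeasure_density dest: prob_space.emeasure_space_1 intro!: prob_spaceI)
  then show ?thesis
    by (auto simp: prob_density_def)
qed

text \<open>Links \<open>prob_density\<close>, whose definition amounts to a nonnegative integral,
  to the Bochner integral in which \<open>opt_weight\<close> is written.\<close>

lemma prob_density_iff_integral:
  "prob_density p \<longleftrightarrow> integrable lborel p \<and> (\<forall>z. 0 \<le> p z) \<and> (\<integral>z. p z \<partial>lborel) = 1"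
  (is "?L \<longleftrightarrow> ?R")
proof
  assume ?L
  then have "p \<in> borel_measurable lborel" "\<And>z. 0 \<le> p z"
    and int: "(\<integral>\<^sup>+ z. ennreal (p z) \<partial>lborel) = ennreal 1"
    by (auto simp: prob_density_iff)
  then show ?R
    using nn_integral_eq_integrable[of p lborel 1] by simp
next
  assume R: ?R
  then have "(\<integral>\<^sup>+ z. ennreal (p z) \<partial>lborel) = ennreal 1"
    by (subst nn_integral_eq_integral) auto
  with R show ?L
    by (auto simp: prob_density_iff)
qed

text \<open>Also covers infinite \<open>A\<close> and \<open>B\<close>: in \<open>ereal\<close>,
  infinity minus infinity is infinity, and a factor \<open>b > 0\<close> preserves this value. For
  \<open>b = 0\<close> both sides are 0, since 0 times infinity is 0.\<close>

lemma ereal_mult_enn2ereal_diff: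
  assumes "0 \<le> b"
  shows "ereal b * (enn2ereal A - enn2ereal B) =
         enn2ereal (ennreal b * A) - enn2ereal (ennreal b * B)"
proof (cases "b = 0")
  case True
  then show ?thesis by (simp add: zero_ereal_def[symmetric] zero_ennreal.rep_eq)
next
  case False
  with assms show ?thesis
    by (cases A; cases B)
      (auto simp: enn2ereal_ennreal ennreal_mult[symmetric] algebra_simps ennreal_mult_top)
qed

text \<open>With finite subtrahends no term is infinity minus infinity, so the terms can be
  regrouped; an infinite \<open>A j\<close> makes both sides infinite.\<close>

lemma sum_enn2ereal_diff:
  assumes "finite S" "\<And>j. j \<in> S \<Longrightarrow> B j < \<infinity>"
  shows "(\<Sum>j\<in>S. enn2ereal (A j) - enn2ereal (B j)) = enn2ereal (\<Sum>j\<in>S. A j) - enn2ereal (\<Sum>j\<in>S. B j)"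
  using assms
proof (induction S rule: finite_induct)
  case empty
  then show ?case by (simp add: zero_ennreal.rep_eq)
next
  case (insert x F)
  have "(\<Sum>j\<in>F. B j) < \<infinity>" "B x < \<infinity>"
    using insert by (auto simp: less_top)
  moreover have "a - enn2ereal b + (a' - enn2ereal b') = a + a' - (enn2ereal b + enn2ereal b')"
    if "b < \<infinity>" "b' < \<infinity>" for a a' :: ereal and b b'
    using that by (cases b; cases b'; cases a; cases a') (auto simp: enn2ereal_ennreal)
  ultimately show ?case
    using insert by (simp add: plus_ennreal.rep_eq)
qed

text \<open>The premise has the subtracted terms moved across, so that it can come from integrating
  an inequality between nonnegative functions. Finiteness of \<open>B\<close> and \<open>Q\<close>
  allows moving them back, even if \<open>P\<close> or \<open>A\<close> is infinite.\<close>

lemma enn2ereal_diff_le_enn2ereal_diff: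
  assumes "P + B \<le> A + Q" "B < \<infinity>" "Q < \<infinity>"
  shows "enn2ereal P - enn2ereal Q \<le> enn2ereal A - enn2ereal B"
  using assms
  by (cases P; cases A; cases B; cases Q)
    (auto simp: enn2ereal_ennreal ennreal_plus[symmetric] top_unique simp del: ennreal_plus)

section \<open>The cost of a plan through its joint densities\<close>

text \<open>The other summands of the marginal constraint are nonnegative, so each joint density is
  at most \<open>p\<close> almost everywhere. Hence \<open>neg\<close> bounds the negative part of
  every term, and no cost is infinity minus infinity.\<close>

lemma transport_cost_eq:
  assumes "\<And>j. j \<in> {1..N} \<Longrightarrow> 0 \<le> \<beta> j" "\<zeta> \<in> transport_densities N z \<beta> p"
    and [measurable]: "p \<in> borel_measurable borel"
    and c [measurable]: "\<And>j. j \<in> {1..N} \<Longrightarrow> c (z j) \<in> borel_measurable borel"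
    and neg: "\<And>j. j \<in> {1..N} \<Longrightarrow>
           (\<integral>\<^sup>+ y. ennreal (- c (z j) y) \<partial>density lborel (\<lambda>y. ennreal (p y))) < \<infinity>"
  shows "(\<Sum>j=1..N. \<integral>\<^sup>+ y. ennreal (- (\<beta> j * \<zeta> (z j) y * c (z j) y)) \<partial>lborel) < \<infinity>" (is "?fin")
    and "transport_cost c N z \<beta> \<zeta> =
           enn2ereal (\<Sum>j=1..N. \<integral>\<^sup>+ y. ennreal (\<beta> j * \<zeta> (z j) y * c (z j) y) \<partial>lborel) -
           enn2ereal (\<Sum>j=1..N. \<integral>\<^sup>+ y. ennreal (- (\<beta> j * \<zeta> (z j) y * c (z j) y)) \<partial>lborel)"
proof -
  have [measurable]: "\<zeta> (z j) \<in> borel_measurable borel" and nonneg: "0 \<le> \<zeta> (z j) y"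
    if "j \<in> {1..N}" for j y
    using that assms(2) by (auto simp: transport_densities_def prob_density_iff)
  have marg: "AE y in lborel. (\<Sum>j=1..N. \<beta> j * \<zeta> (z j) y) = p y"
    using assms(2) by (auto simp: transport_densities_def)
  have fin: "(\<integral>\<^sup>+ y. ennreal (- (\<beta> j * \<zeta> (z j) y * c (z j) y)) \<partial>lborel) < \<infinity>" if j: "j \<in> {1..N}" for j
  proof -
    have "AE y in lborel. ennreal (- (\<beta> j * \<zeta> (z j) y * c (z j) y)) \<le> ennreal (p y) * ennreal (- c (z j) y)"
      using marg
    proof eventually_elim
      case (elim y)
      have "0 \<le> \<beta> j * \<zeta> (z j) y"
        using j assms(1) nonneg by simp
      moreover have "\<beta> j * \<zeta> (z j) y \<le> p y"
        unfolding elim[symmetric] using j assms(1) nonneg by (intro member_le_sum) auto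
      ultimately show ?case
        \<comment> \<open>For positive cost the left side is 0, because \<open>ennreal\<close>
          truncates negative reals. Otherwise the bound by \<open>p y\<close> is multiplied by the
          nonnegative number \<open>- c (z j) y\<close>.\<close>
        by (cases "c (z j) y \<le> 0")
          (auto simp: ennreal_mult[symmetric] mult_right_mono_neg ennreal_neg intro!: ennreal_leI)
    qed
    then have "(\<integral>\<^sup>+ y. ennreal (- (\<beta> j * \<zeta> (z j) y * c (z j) y)) \<partial>lborel) \<le>
               (\<integral>\<^sup>+ y. ennreal (p y) * ennreal (- c (z j) y) \<partial>lborel)"
      by (rule nn_integral_mono_AE)
    also have "\<dots> < \<infinity>"
      using neg[OF j] c[OF j] by (simp add: nn_integral_density)
    finally show ?thesis .
  qed
  then show ?fin by (auto simp: less_top)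
  \<comment> \<open>The function \<open>f\<close> is arbitrary so that this serves both parts of the
    expectation, with \<open>f\<close> the cost and its negative.\<close>
  have scale: "ennreal (\<beta> j) * (\<integral>\<^sup>+ y. ennreal (f y) \<partial>density lborel (\<lambda>y. ennreal (\<zeta> (z j) y))) =
        (\<integral>\<^sup>+ y. ennreal (\<beta> j * \<zeta> (z j) y * f y) \<partial>lborel)"
    if j: "j \<in> {1..N}" and [measurable]: "f \<in> borel_measurable borel" for j f
  proof -
    note [measurable] = c[OF j]
    have "ennreal (\<beta> j) * (\<integral>\<^sup>+ y. ennreal (f y) \<partial>density lborel (\<lambda>y. ennreal (\<zeta> (z j) y))) =
        (\<integral>\<^sup>+ y. ennreal (\<beta> j) * (ennreal (\<zeta> (z j) y) * ennreal (f y)) \<partial>lborel)"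
      using j by (simp add: nn_integral_density nn_integral_cmult)
    also have "\<dots> = (\<integral>\<^sup>+ y. ennreal (\<beta> j * \<zeta> (z j) y * f y) \<partial>lborel)"
      using assms(1)[OF j] nonneg[OF j]
      by (intro nn_integral_cong) (simp add: ennreal_mult' mult.assoc)
    finally show ?thesis .
  qed
  have "transport_cost c N z \<beta> \<zeta> =
      (\<Sum>j=1..N. enn2ereal (\<integral>\<^sup>+ y. ennreal (\<beta> j * \<zeta> (z j) y * c (z j) y) \<partial>lborel) -
                 enn2ereal (\<integral>\<^sup>+ y. ennreal (- (\<beta> j * \<zeta> (z j) y * c (z j) y)) \<partial>lborel))"
    unfolding transport_cost_def ext_expectation_def
    using assms(1) c scale by (intro sum.cong refl) (simp add: ereal_mult_enn2ereal_diff)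
  also have "\<dots> = enn2ereal (\<Sum>j=1..N. \<integral>\<^sup>+ y. ennreal (\<beta> j * \<zeta> (z j) y * c (z j) y) \<partial>lborel) -
           enn2ereal (\<Sum>j=1..N. \<integral>\<^sup>+ y. ennreal (- (\<beta> j * \<zeta> (z j) y * c (z j) y)) \<partial>lborel)"
    using fin by (intro sum_enn2ereal_diff) auto
  finally show "transport_cost c N z \<beta> \<zeta> =
           enn2ereal (\<Sum>j=1..N. \<integral>\<^sup>+ y. ennreal (\<beta> j * \<zeta> (z j) y * c (z j) y) \<partial>lborel) -
           enn2ereal (\<Sum>j=1..N. \<integral>\<^sup>+ y. ennreal (- (\<beta> j * \<zeta> (z j) y * c (z j) y)) \<partial>lborel)" .
qed

section \<open>Pointwise comparison of two plans and its integration\<close>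

text \<open>This is the transport problem at one target point. With \<open>m\<close> the minimum of
  \<open>f\<close>, the weights \<open>a\<close> pay at least \<open>m\<close> per unit of mass,
  while \<open>b\<close> pays exactly \<open>m\<close>; the total masses agree.\<close>

lemma sum_weights_minimal:
  fixes a b f :: "'i \<Rightarrow> real"
  assumes "finite S" "sum a S = sum b S" "\<And>j. j \<in> S \<Longrightarrow> 0 \<le> a j"
    and slack: "\<And>j k. j \<in> S \<Longrightarrow> k \<in> S \<Longrightarrow> b j \<noteq> 0 \<Longrightarrow> f j \<le> f k"
  shows "(\<Sum>j\<in>S. b j * f j) \<le> (\<Sum>j\<in>S. a j * f j)"
proof (cases "S = {}")
  case False
  define m where "m = Min (f ` S)"
  have m: "m \<le> f j" if "j \<in> S" for j
    using that assms(1) by (simp add: m_def)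
  have "m \<in> f ` S"
    unfolding m_def using assms(1) False by (intro Min_in) auto
  then obtain k where k: "k \<in> S" "m = f k" by blast
  have "b j * f j = b j * m" if j: "j \<in> S" for j
  proof (cases "b j = 0")
    case False
    then have "f j \<le> m" using slack[OF j k(1)] k(2) by simp
    with m[OF j] show ?thesis by simp
  qed simp
  then have "(\<Sum>j\<in>S. b j * f j) = sum b S * m"
    unfolding sum_distrib_right by (rule sum.cong[OF refl])
  also have "\<dots> = (\<Sum>j\<in>S. a j * m)"
    by (simp add: assms(2)[symmetric] sum_distrib_right)
  also have "\<dots> \<le> (\<Sum>j\<in>S. a j * f j)"
    using assms(3) m by (intro sum_mono mult_left_mono) auto
  finally show ?thesis .
qed simp

text \<open>Splitting each term into positive and negative parts and moving the negative ones across
  removes all subtractions, so the result can be integrated without integrability of the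
  costs.\<close>

lemma sum_parts_le:
  fixes u v :: "'i \<Rightarrow> real"
  assumes "sum u S \<le> sum v S"
  shows "(\<Sum>j\<in>S. ennreal (u j)) + (\<Sum>j\<in>S. ennreal (- v j)) \<le>
         (\<Sum>j\<in>S. ennreal (v j)) + (\<Sum>j\<in>S. ennreal (- u j))"
proof -
  have "(\<Sum>j\<in>S. w j) = (\<Sum>j\<in>S. max 0 (w j)) - (\<Sum>j\<in>S. max 0 (- w j))" for w :: "'i \<Rightarrow> real"
    by (simp add: sum_subtractf[symmetric]) (intro sum.cong refl; simp add: max_def)
  from this[of u] this[of v] assms
  have "(\<Sum>j\<in>S. max 0 (u j)) + (\<Sum>j\<in>S. max 0 (- v j)) \<le> (\<Sum>j\<in>S. max 0 (v j)) + (\<Sum>j\<in>S. max 0 (- u j))"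
    by linarith
  \<comment> \<open>\<open>ennreal\<close> truncates at 0, so only positive parts enter, and on
    these it is additive.\<close>
  moreover have "(\<Sum>j\<in>S. ennreal (w j)) = ennreal (\<Sum>j\<in>S. max 0 (w j))" for w :: "'i \<Rightarrow> real"
    by (simp add: sum_ennreal[symmetric] ennreal_max_0 del: sum_ennreal)
  ultimately show ?thesis
    by (simp add: ennreal_plus[symmetric] sum_nonneg ennreal_leI del: ennreal_plus)
qed

lemma nn_integral_add_sums:
  fixes u v :: "'i \<Rightarrow> 'a \<Rightarrow> real"
  assumes [measurable]: "\<And>j. j \<in> S \<Longrightarrow> u j \<in> borel_measurable M" "\<And>j. j \<in> S \<Longrightarrow> v j \<in> borel_measurable M"
  shows "(\<integral>\<^sup>+ y. (\<Sum>j\<in>S. ennreal (u j y)) + (\<Sum>j\<in>S. ennreal (- v j y)) \<partial>M) =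
    (\<Sum>j\<in>S. \<integral>\<^sup>+ y. ennreal (u j y) \<partial>M) + (\<Sum>j\<in>S. \<integral>\<^sup>+ y. ennreal (- v j y) \<partial>M)"
  by (subst nn_integral_add) (measurable, simp add: nn_integral_sum)

text \<open>The last assumption is complementary slackness: \<^term>\<open>\<zeta>\<close> only moves mass to nearest particles.\<close>

lemma transport_cost_le:
  assumes p: "p \<in> borel_measurable borel"
    and c: "\<And>j. j \<in> {1..N} \<Longrightarrow> c (z j) \<in> borel_measurable borel"
    and neg: "\<And>j. j \<in> {1..N} \<Longrightarrow>
           (\<integral>\<^sup>+ y. ennreal (- c (z j) y) \<partial>density lborel (\<lambda>y. ennreal (p y))) < \<infinity>"
    and \<beta>: "\<And>j. j \<in> {1..N} \<Longrightarrow> 0 \<le> \<beta> j" and \<zeta>: "\<zeta> \<in> transport_densities N z \<beta> p"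
    and \<gamma>: "\<And>j. j \<in> {1..N} \<Longrightarrow> 0 \<le> \<gamma> j" and \<xi>: "\<xi> \<in> transport_densities N z \<gamma> p"
    and slack: "AE y in lborel. \<forall>j\<in>{1..N}. \<forall>k\<in>{1..N}. \<beta> j * \<zeta> (z j) y \<noteq> 0 \<longrightarrow> c (z j) y \<le> c (z k) y"
  shows "transport_cost c N z \<beta> \<zeta> \<le> transport_cost c N z \<gamma> \<xi>"
proof -
  note cost\<beta> = transport_cost_eq[where c = c and z = z, OF \<beta> \<zeta> p c neg, simplified]
  note cost\<gamma> = transport_cost_eq[where c = c and z = z, OF \<gamma> \<xi> p c neg, simplified]
  let ?u = "\<lambda>j y. \<beta> j * \<zeta> (z j) y * c (z j) y" and ?v = "\<lambda>j y. \<gamma> j * \<xi> (z j) y * c (z j) y"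
  have meas: "?u j \<in> borel_measurable lborel" "?v j \<in> borel_measurable lborel" if j: "j \<in> {1..N}" for j
  proof -
    have [measurable]: "\<zeta> (z j) \<in> borel_measurable borel" "\<xi> (z j) \<in> borel_measurable borel"
      using j \<zeta> \<xi> by (auto simp: transport_densities_def prob_density_iff)
    note [measurable] = c[OF j]
    show "?u j \<in> borel_measurable lborel" "?v j \<in> borel_measurable lborel"
      by simp_all
  qed
  have "AE y in lborel. (\<Sum>j=1..N. \<beta> j * \<zeta> (z j) y) = p y" "AE y in lborel. (\<Sum>j=1..N. \<gamma> j * \<xi> (z j) y) = p y"
    using \<zeta> \<xi> by (auto simp: transport_densities_def)
  then have "AE y in lborel. (\<Sum>j=1..N. ennreal (?u j y)) + (\<Sum>j=1..N. ennreal (- ?v j y)) \<le>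
      (\<Sum>j=1..N. ennreal (?v j y)) + (\<Sum>j=1..N. ennreal (- ?u j y))"
    using slack
  proof eventually_elim
    case (elim y)
    have "0 \<le> \<gamma> j * \<xi> (z j) y" if "j \<in> {1..N}" for j
      using that \<gamma> \<xi> by (auto simp: transport_densities_def prob_density_iff)
    \<comment> \<open>At \<open>y\<close> both families of joint masses sum to \<open>p y\<close> by
      their marginal constraints, and \<open>slack\<close> puts the masses of \<zeta> on cheapest
      particles.\<close>
    with elim show ?case
      by (intro sum_parts_le sum_weights_minimal) auto
  qed
  then have "(\<integral>\<^sup>+ y. (\<Sum>j=1..N. ennreal (?u j y)) + (\<Sum>j=1..N. ennreal (- ?v j y)) \<partial>lborel) \<le>
      (\<integral>\<^sup>+ y. (\<Sum>j=1..N. ennreal (?v j y)) + (\<Sum>j=1..N. ennreal (- ?u j y)) \<partial>lborel)"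
    by (rule nn_integral_mono_AE)
  also have "(\<integral>\<^sup>+ y. (\<Sum>j=1..N. ennreal (?u j y)) + (\<Sum>j=1..N. ennreal (- ?v j y)) \<partial>lborel) =
      (\<Sum>j=1..N. \<integral>\<^sup>+ y. ennreal (?u j y) \<partial>lborel) + (\<Sum>j=1..N. \<integral>\<^sup>+ y. ennreal (- ?v j y) \<partial>lborel)"
    using meas by (rule nn_integral_add_sums)
  also have "(\<integral>\<^sup>+ y. (\<Sum>j=1..N. ennreal (?v j y)) + (\<Sum>j=1..N. ennreal (- ?u j y)) \<partial>lborel) =
      (\<Sum>j=1..N. \<integral>\<^sup>+ y. ennreal (?v j y) \<partial>lborel) + (\<Sum>j=1..N. \<integral>\<^sup>+ y. ennreal (- ?u j y) \<partial>lborel)"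
    using meas(2,1) by (rule nn_integral_add_sums)
  finally show ?thesis
    unfolding cost\<beta>(2) cost\<gamma>(2)
    using cost\<beta>(1) cost\<gamma>(1) by (intro enn2ereal_diff_le_enn2ereal_diff) auto
qed

section \<open>The tessellation and the plan it induces\<close>

lemma cell_disjoint:
  assumes "j \<in> {1..N}" "k \<in> {1..N}" "y \<in> cell c N z j" "y \<in> cell c N z k"
  shows "j = k"
proof (rule ccontr)
  assume "j \<noteq> k"
  then have "c (z j) y < c (z k) y" "c (z k) y < c (z j) y"
    using assms by (simp_all add: cell_def)
  then show False by simp
qed

lemma sets_cell:
  assumes "\<And>j. j \<in> {1..N} \<Longrightarrow> c (z j) \<in> borel_measurable borel" "j \<in> {1..N}"
  shows "cell c N z j \<in> sets borel"
proof -
  have "{y \<in> space borel. k \<noteq> j \<longrightarrow> c (z j) y < c (z k) y} \<in> sets borel" if "k \<in> {1..N}" for k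
    using borel_measurable_less[OF assms(1)[OF assms(2)] assms(1)[OF that]]
    by (cases "k = j") (simp_all only: simp_thms Collect_mem_eq sets.top)
  then have "{y \<in> space borel. \<forall>k\<in>{1..N}. k \<noteq> j \<longrightarrow> c (z j) y < c (z k) y} \<in> sets borel"
    by (rule sets.sets_Collect_finite_All[OF _ finite_atLeastAtMost])
  then show ?thesis
    by (simp only: cell_def space_borel UNIV_I simp_thms)
qed

lemma sum_indicator_cell:
  assumes "\<exists>j\<in>{1..N}. y \<in> cell c N z j"
  shows "(\<Sum>j=1..N. a * indicator (cell c N z j) y) = (a :: real)"
proof -
  from assms obtain i where i: "i \<in> {1..N}" "y \<in> cell c N z i" by blast
  have "(\<Sum>j=1..N. a * indicator (cell c N z j) y) = (\<Sum>j=1..N. if j = i then a else 0)"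
  proof (intro sum.cong refl)
    fix j assume "j \<in> {1..N}"
    then have "y \<in> cell c N z j \<longleftrightarrow> j = i"
      using i cell_disjoint by metis
    then show "a * indicator (cell c N z j) y = (if j = i then a else 0)"
      using i(2) by simp
  qed
  with i show ?thesis by simp
qed

context
  fixes p :: "'a::euclidean_space \<Rightarrow> real" and c N z
  assumes p: "prob_density p"
    and c: "\<And>j. j \<in> {1..N} \<Longrightarrow> c (z j) \<in> borel_measurable borel"
    and cover: "AE y in density lborel (\<lambda>y. ennreal (p y)). \<exists>j\<in>{1..N}. y \<in> cell c N z j"
begin

text \<open>\<open>cover\<close> says that ties for the cheapest particle have probability 0 under
  \<open>p\<close>. Thus for Lebesgue-almost every \<open>y\<close>, either \<open>y\<close> lies in
  exactly one cell or \<open>p y = 0\<close>.\<close>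

lemma AE_sum_cells: "AE y in lborel. (\<Sum>j=1..N. p y * indicator (cell c N z j) y) = p y"
proof -
  have [measurable]: "p \<in> borel_measurable borel" and nonneg: "\<And>y. 0 \<le> p y"
    using p by (auto simp: prob_density_iff)
  have "AE y in lborel. 0 < ennreal (p y) \<longrightarrow> (\<exists>j\<in>{1..N}. y \<in> cell c N z j)"
    using cover by (subst (asm) AE_density) auto
  then show ?thesis
  proof eventually_elim
    case (elim y)
    show ?case
    proof (cases "p y = 0")
      case False
      then have "0 < ennreal (p y)" using nonneg[of y] by simp
      with elim show ?thesis by (intro sum_indicator_cell) auto
    qed simp
  qed
qed

lemma integrable_cell:
  assumes "j \<in> {1..N}"
  shows "integrable lborel (\<lambda>y. p y * indicator (cell c N z j) y)"
  using p sets_cell[of N c z j, OF c assms]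
  by (auto simp: prob_density_iff_integral intro!: integrable_real_mult_indicator)

lemma opt_weight_eq: "opt_weight c N z p j = (\<integral>y. p y * indicator (cell c N z j) y \<partial>lborel)"
  by (simp add: opt_weight_def set_lebesgue_integral_def mult.commute)

lemma opt_weight_nonneg: "0 \<le> opt_weight c N z p j"
  using p by (auto simp: opt_weight_eq prob_density_iff intro!: integral_nonneg_AE)

text \<open>The cells split the total mass 1 of \<open>p\<close> without loss, by
  \<open>AE_sum_cells\<close>.\<close>

lemma particle_weights_opt_weight: "particle_weights N (opt_weight c N z p)"
proof -
  have "(\<Sum>j=1..N. opt_weight c N z p j) = (\<integral>y. (\<Sum>j=1..N. p y * indicator (cell c N z j) y) \<partial>lborel)"
    unfolding opt_weight_eq using integrable_cell by (subst Bochner_Integration.integral_sum) auto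
  also have "\<dots> = (\<integral>y. p y \<partial>lborel)"
    using AE_sum_cells p borel_measurable_integrable[OF integrable_cell]
    by (intro integral_cong_AE borel_measurable_sum) (auto simp: prob_density_iff)
  also have "\<dots> = 1"
    using p by (simp add: prob_density_iff_integral)
  finally show ?thesis
    using opt_weight_nonneg by (simp add: particle_weights_def)
qed

lemma prob_density_restricted_density:
  assumes "j \<in> {1..N}" "opt_weight c N z p j \<noteq> 0"
  shows "prob_density (restricted_density c N z p j)"
proof -
  have eq: "restricted_density c N z p j =
      (\<lambda>y. 1 / opt_weight c N z p j * (p y * indicator (cell c N z j) y))"
    by (auto simp: restricted_density_def)
  have "0 \<le> p y" for y
    using p by (simp add: prob_density_iff)
  moreover have "(\<integral>y. restricted_density c N z p j y \<partial>lborel) = 1"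
    unfolding eq by (simp only: integral_mult_right_zero opt_weight_eq[symmetric]) (simp add: assms(2))
  ultimately show ?thesis
    using opt_weight_nonneg integrable_cell[OF assms(1)]
    by (auto simp: prob_density_iff_integral eq intro!: integrable_mult_right)
qed

lemma ex_cell_transport:
  obtains \<zeta> where "\<zeta> \<in> transport_densities N z (opt_weight c N z p) p"
    and "\<And>j. j \<in> {1..N} \<Longrightarrow> opt_weight c N z p j \<noteq> 0 \<Longrightarrow> \<zeta> (z j) = restricted_density c N z p j"
proof -
  let ?w = "opt_weight c N z p"
  \<comment> \<open>A plan is indexed by positions, so an index of nonzero weight must be recovered
    from \<open>x\<close>. Where there is none, the weight is 0 and any probability density is
    admissible; \<open>p\<close> is one at hand.\<close>
  define \<zeta> where "\<zeta> x =
    (if \<exists>j\<in>{1..N}. z j = x \<and> ?w j \<noteq> 0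
     then restricted_density c N z p (SOME j. j \<in> {1..N} \<and> z j = x \<and> ?w j \<noteq> 0) else p)" for x
  \<comment> \<open>Particles at the same position have empty cells.\<close>
  have inj: "j = k" if jk: "j \<in> {1..N}" "k \<in> {1..N}" "?w j \<noteq> 0" "z j = z k" for j k
  proof (rule ccontr)
    assume "j \<noteq> k"
    have "y \<notin> cell c N z j" for y
    proof
      assume "y \<in> cell c N z j"
      then have "c (z j) y < c (z k) y"
        using jk(2) \<open>j \<noteq> k\<close> by (simp add: cell_def)
      then show False using jk(4) by simp
    qed
    then have "cell c N z j = {}" by blast
    with jk(3) show False
      by (simp add: opt_weight_eq)
  qed
  have restr: "\<zeta> (z j) = restricted_density c N z p j" if j: "j \<in> {1..N}" "?w j \<noteq> 0" for j
  proof -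
    have "(SOME k. k \<in> {1..N} \<and> z k = z j \<and> ?w k \<noteq> 0) = j"
      using j inj by (intro some_equality) auto
    with j show ?thesis by (auto simp: \<zeta>_def)
  qed
  have dens: "prob_density (\<zeta> (z j))" if "j \<in> {1..N}" for j
  proof (cases "\<exists>k\<in>{1..N}. z k = z j \<and> ?w k \<noteq> 0")
    case True
    then obtain k where "k \<in> {1..N}" "z k = z j" "?w k \<noteq> 0" by blast
    then show ?thesis
      using restr[of k] prob_density_restricted_density[of k] by simp
  next
    case False
    then show ?thesis unfolding \<zeta>_def by (subst if_not_P) (use p in auto)
  qed
  have "AE y in lborel. ?w j * \<zeta> (z j) y = p y * indicator (cell c N z j) y" if j: "j \<in> {1..N}" for j
  proof (cases "?w j = 0")
    case True
    \<comment> \<open>A vanishing integral of a nonnegative function: the cell carries no mass of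
      \<open>p\<close>, so dropping it leaves the marginal unchanged.\<close>
    then have "AE y in lborel. p y * indicator (cell c N z j) y = 0"
      using integrable_cell[OF j] p
      by (subst (asm) opt_weight_eq, subst (asm) integral_nonneg_eq_0_iff_AE) (auto simp: prob_density_iff)
    with True show ?thesis by simp
  next
    case False
    then show ?thesis by (simp add: restr[OF j] restricted_density_def)
  qed
  then have "AE y in lborel. \<forall>j\<in>{1..N}. ?w j * \<zeta> (z j) y = p y * indicator (cell c N z j) y"
    by (intro AE_finite_allI) auto
  then have "AE y in lborel. (\<Sum>j=1..N. ?w j * \<zeta> (z j) y) = p y"
    using AE_sum_cells by eventually_elim simp
  with dens have "\<zeta> \<in> transport_densities N z ?w p"
    by (simp add: transport_densities_def)
  with restr show ?thesis
    using that by blast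
qed

end

section \<open>Joint optimality of the cell weights and the cell plan\<close>

theorem theorem1:
  fixes p :: "real ^ 'd \<Rightarrow> real"
    and c :: "real ^ 'd \<Rightarrow> real ^ 'd \<Rightarrow> real"
    and z :: "nat \<Rightarrow> real ^ 'd"
    and N :: nat
  assumes "prob_density p"
    and "\<And>j. j \<in> {1..N} \<Longrightarrow> c (z j) \<in> borel_measurable borel"
    and "\<And>j. j \<in> {1..N} \<Longrightarrow>
           (\<integral>\<^sup>+ z'. ennreal (- c (z j) z') \<partial>density lborel (\<lambda>z'. ennreal (p z'))) < \<infinity>"
    and "AE z' in density lborel (\<lambda>z'. ennreal (p z')). \<exists>j\<in>{1..N}. z' \<in> cell c N z j"
  shows "is_arg_min (ot_divergence c N z p) (particle_weights N) (opt_weight c N z p) \<and>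
         (\<exists>\<zeta>. is_arg_min (transport_cost c N z (opt_weight c N z p))
               (\<lambda>\<zeta>. \<zeta> \<in> transport_densities N z (opt_weight c N z p) p) \<zeta> \<and>
             (\<forall>j\<in>{1..N}. opt_weight c N z p j \<noteq> 0 \<longrightarrow>
               \<zeta> (z j) = restricted_density c N z p j))"
proof -
  let ?w = "opt_weight c N z p"
  have w: "particle_weights N ?w"
    using assms(1,2,4) by (rule particle_weights_opt_weight)
  have p: "p \<in> borel_measurable borel"
    using assms(1) by (simp add: prob_density_iff)
  obtain \<zeta> where \<zeta>: "\<zeta> \<in> transport_densities N z ?w p"
    and restr: "\<And>j. j \<in> {1..N} \<Longrightarrow> ?w j \<noteq> 0 \<Longrightarrow> \<zeta> (z j) = restricted_density c N z p j"
    using ex_cell_transport[where c = c and z = z and N = N, OF assms(1,2,4)] by blast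
  \<comment> \<open>A nonzero joint mass has nonzero weight, so \<open>restr\<close> applies and its
    indicator places \<open>y\<close> in the cell of \<open>j\<close>.\<close>
  have slack: "c (z j) y \<le> c (z k) y"
    if "j \<in> {1..N}" "k \<in> {1..N}" "?w j * \<zeta> (z j) y \<noteq> 0" for j k y
  proof -
    have "y \<in> cell c N z j"
      using that restr[of j] by (auto simp: restricted_density_def indicator_def split: if_splits)
    with that(2) show ?thesis
      by (cases "k = j") (auto simp: cell_def)
  qed
  \<comment> \<open>The weights may differ, since only the common marginal \<open>p\<close> matters.
    Arbitrary \<beta> gives optimality of the weights, and the choice \<open>?w\<close> gives
    optimality of the plan.\<close>
  have cost: "transport_cost c N z ?w \<zeta> \<le> transport_cost c N z \<beta> \<xi>"
    if "particle_weights N \<beta>" "\<xi> \<in> transport_densities N z \<beta> p" for \<beta> \<xi>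
    using transport_cost_le[where c = c and z = z, OF p assms(2,3) _ \<zeta> _ that(2)] that(1) w slack
    by (simp add: particle_weights_def)
  have "ot_divergence c N z p ?w \<le> ot_divergence c N z p \<beta>" if "particle_weights N \<beta>" for \<beta>
    unfolding ot_divergence_def
    using cost[OF that] by (intro INF_greatest) (blast intro: INF_lower2[OF \<zeta>])
  moreover have "is_arg_min (transport_cost c N z ?w) (\<lambda>\<zeta>. \<zeta> \<in> transport_densities N z ?w p) \<zeta>"
    using \<zeta> cost[OF w] by (auto simp: is_arg_min_def not_less)
  ultimately show ?thesis
    using w restr by (auto simp: is_arg_min_def not_less)
qed

end
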